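(* Let $I$ be a non-empty set, $T=\{z\in\mathbb{C}:|z|=1\}$, and let $K\subseteq T^I$ be a compact set with $\lambda(K)>0$, where $\lambda$ is the product measure on $T^I$ of the normalised Lebesgue measures $\frac{d\theta}{2\pi}$ on each factor $T$. Then $K$ is a set of uniqueness for $A(\overline{D}^I)$: whenever $f,g\in A(\overline{D}^I)$ satisfy $f|_K=g|_K$, then $f\equiv g$ on $\overline{D}^I$.
   Context: $\overline{D}=\{z\in\mathbb{C}:|z|\le1\}$, $\overline{D}^I$ and $T^I$ carry the product topology, and $\lambda$ is understood as the regular Borel probability product measure on the compact space $T^I$. $A(\overline{D}^I)$ is the set of all functions $f:\overline{D}^I\to\mathbb{C}$ that are continuous on $\overline{D}^I$ and such that for every $i_0\in I$ and every $z=(z_i)_{i\in I}\in\overline{D}^I$, the function $w\mapsto f(\zeta(w))$ belongs to the disc algebra $A(\overline{D})$ (continuous on $\overline{D}$, holomorphic on the open disc), where $\zeta(w)_{i_0}=w$ and $\zeta(w)_i=z_i$ for $i\neq i_0$. *)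

theory Defs
  imports "HOL-Probability.Probability"
begin

definition polydisc :: "'i set \<Rightarrow> ('i \<Rightarrow> complex) set" where
  "polydisc I = PiE I (\<lambda>_. cball 0 1)"

definition torus :: "'i set \<Rightarrow> ('i \<Rightarrow> complex) set" where
  "torus I = PiE I (\<lambda>_. sphere 0 1)"

definition polydisc_top :: "'i set \<Rightarrow> ('i \<Rightarrow> complex) topology" where
  "polydisc_top I = product_topology (\<lambda>_. top_of_set (cball (0::complex) 1)) I"

definition torus_top :: "'i set \<Rightarrow> ('i \<Rightarrow> complex) topology" where
  "torus_top I = product_topology (\<lambda>_. top_of_set (sphere (0::complex) 1)) I"

definition polydisc_algebra :: "'i set \<Rightarrow> (('i \<Rightarrow> complex) \<Rightarrow> complex) set" where
  "polydisc_algebra I =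
     {f. continuous_map (polydisc_top I) euclidean f \<and>
         (\<forall>i0\<in>I. \<forall>z\<in>polydisc I.
             continuous_on (cball 0 1) (\<lambda>w. f (z(i0 := w))) \<and>
             (\<lambda>w. f (z(i0 := w))) holomorphic_on ball 0 1)}"

definition circle_measure :: "complex measure" where
  "circle_measure = distr (uniform_measure lborel {0..<2*pi}) (restrict_space borel (sphere 0 1)) cis"

definition torus_measure :: "'i set \<Rightarrow> ('i \<Rightarrow> complex) measure" where
  "torus_measure I = PiM I (\<lambda>_. circle_measure)"

definition outer_emeasure :: "'a measure \<Rightarrow> 'a set \<Rightarrow> ennreal" where
  "outer_emeasure M A = (INF B \<in> {B \<in> sets M. A \<subseteq> B}. emeasure M B)"

end

theory Submission
  imports Defs "HOL-Complex_Analysis.Complex_Analysis"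
begin

text \<open>
  Scale \<open>h = f - g\<close> so that \<open>\<bar>h\<bar> \<le> 1\<close>. In one variable, \<open>ln (max \<bar>u\<bar> e)\<close> at a point \<open>a\<close> of the disc is at
  most \<open>(1 - \<bar>a\<bar>) / (1 + \<bar>a\<bar>)\<close> times its mean over the circle: approximate it on the circle by
  \<open>Re p\<close> with \<open>p\<close> a polynomial, apply the maximum principle to \<open>u exp (-p)\<close>, and Harnack's inequality
  to \<open>Re p\<close>. By Fubini the same holds in finitely many variables, with the product of the
  constants, and this product does not grow with the number of variables as long as the support
  of \<open>a\<close> is a fixed finite set. By compactness \<open>h\<close> is within \<open>e\<close> of a function of finitely many
  variables, which is then at most \<open>e\<close> in absolute value on a set of measure at least that of \<open>K\<close>.
  Hence \<open>ln \<bar>h a\<bar> \<le> C d ln e\<close> with \<open>C, d > 0\<close> independent of \<open>e\<close>, and \<open>e \<rightarrow> 0\<close> gives \<open>h a = 0\<close>.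
\<close>

subsection \<open>The mean value inequality on the disc\<close>

text \<open>With \<open>s = Re (p 0)\<close>, the Cayley transform
  \<open>q = (P - s) / (P + s)\<close> maps the disc into itself and fixes 0, so
  \<open>norm (q a) \<le> norm a\<close> by Schwarz. Solving for \<open>P\<close> gives
  \<open>Re (P a) \<ge> s (1 - norm (q a)) / (1 + norm (q a))\<close>, which decreases in
  \<open>norm (q a)\<close>.\<close>

lemma Harnack_lower_bound:
  assumes "p holomorphic_on ball 0 1" "\<And>z. norm z < 1 \<Longrightarrow> Re (p z) > 0" "norm a < 1"
  shows "(1 - norm a) / (1 + norm a) * Re (p 0) \<le> Re (p a)"
proof -
  define s where "s = Re (p 0)"
  \<comment> \<open>Removing the imaginary part at 0 makes \<open>P 0\<close> equal to the real
    number \<open>s\<close>, hence \<open>q 0 = 0\<close>.\<close>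
  define P where "P z = p z - \<i> * Im (p 0)" for z
  have s: "s > 0"
    using assms(2)[of 0] by (simp add: s_def)
  have P0: "P 0 = of_real s"
    by (simp add: P_def s_def complex_eq_iff)
  have ReP: "Re (P z) = Re (p z)" for z
    by (simp add: P_def)
  have nz: "P z + of_real s \<noteq> 0" if "norm z < 1" for z
  proof -
    have "Re (P z + of_real s) > 0"
      using assms(2)[OF that] s by (simp add: ReP)
    then show ?thesis
      by (metis less_irrefl zero_complex.sel(1))
  qed
  define q where "q z = (P z - of_real s) / (P z + of_real s)" for z
  have "norm (q a) \<le> norm a"
  proof (rule Schwarz_Lemma(1))
    show "q holomorphic_on ball 0 1"
      unfolding q_def using nz by (auto simp: P_def intro!: holomorphic_intros assms(1))
    show "norm (q z) < 1" if "norm z < 1" for z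
    proof -
      \<comment> \<open>The imaginary parts of \<open>P z - s\<close> and \<open>P z + s\<close>
        coincide, so the moduli compare as the real parts do.\<close>
      have "(Re (P z) - s)\<^sup>2 < (Re (P z) + s)\<^sup>2"
        using assms(2)[OF that] s by (simp add: ReP power2_eq_square algebra_simps)
      then have "norm (P z - of_real s) < norm (P z + of_real s)"
        by (simp add: cmod_def)
      then show ?thesis
        using nz[OF that] by (simp add: q_def norm_divide)
    qed
  qed (use assms(3) in \<open>auto simp: q_def P0\<close>)
  then have qa: "norm (q a) \<le> norm a" .
  have q1: "1 - q a \<noteq> 0"
    using qa assms(3) by auto
  have Pa: "P a = of_real s * ((1 + q a) / (1 - q a))"
  proof -
    have "(1 - q a) * (P a + of_real s) = 2 * of_real s" "(1 + q a) * (P a + of_real s) = 2 * P a"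
      using nz[OF assms(3)] by (simp_all add: q_def field_simps)
    then have "(1 - q a) * P a * (P a + of_real s) = of_real s * (1 + q a) * (P a + of_real s)"
      by algebra
    then have "(1 - q a) * P a = of_real s * (1 + q a)"
      using nz[OF assms(3)] by simp
    then show ?thesis
      using q1 by (simp add: field_simps)
  qed
  have Re: "Re ((1 + q a) / (1 - q a)) = (1 - (norm (q a))\<^sup>2) / (norm (1 - q a))\<^sup>2"
    by (simp add: Re_divide cmod_power2) (simp add: power2_eq_square algebra_simps)
  have "(norm (1 - q a))\<^sup>2 \<le> (1 + norm (q a))\<^sup>2"
    by (intro power_mono) (use norm_triangle_ineq4[of 1 "q a"] in auto)
  then have "(1 - (norm (q a))\<^sup>2) / (1 + norm (q a))\<^sup>2 \<le> Re ((1 + q a) / (1 - q a))"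
    unfolding Re using q1 qa assms(3)
    by (intro divide_left_mono mult_pos_pos zero_less_power) (auto simp: abs_square_le_1 add_pos_nonneg)
  moreover have "(1 - (norm (q a))\<^sup>2) / (1 + norm (q a))\<^sup>2 = (1 - norm (q a)) / (1 + norm (q a))"
    using norm_ge_zero[of "q a"] by (simp add: divide_simps) (simp add: power2_eq_square algebra_simps)
  moreover have "(1 - norm a) / (1 + norm a) \<le> (1 - norm (q a)) / (1 + norm (q a))"
    using qa assms(3) by (intro frac_le) (auto simp: add_pos_nonneg)
  ultimately have "(1 - norm a) / (1 + norm a) \<le> Re ((1 + q a) / (1 - q a))"
    by linarith
  then have "s * ((1 - norm a) / (1 + norm a)) \<le> s * Re ((1 + q a) / (1 - q a))"
    using s by (intro mult_left_mono) auto
  also have "\<dots> = Re (P a)"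
    by (simp add: Pa del: times_divide_eq_right)
  finally show ?thesis
    by (simp add: ReP s_def mult.commute)
qed

section \<open>Density of real parts of polynomials on the circle\<close>

text \<open>\<open>2 Re v Re w = Re (v w) + Re (cnj v w)\<close>, and on the circle
  \<open>cnj z\<close> is the inverse of \<open>z\<close>, so for \<open>m \<le> n\<close> the
  second term is again the real part of a monomial, of degree \<open>n - m\<close>.\<close>

lemma Re_monom_mult_on_circle:
  fixes a b :: complex
  shows "\<exists>p. \<forall>z\<in>sphere 0 1. Re (poly (monom a m) z) * Re (poly (monom b n) z) = Re (poly p z)"
proof (induction m n arbitrary: a b rule: linorder_wlog)
  case (le m n)
  show ?case
  proof (intro exI ballI)
    fix z :: complex assume "z \<in> sphere 0 1"
    then have z: "cnj z ^ m * z ^ m = 1"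
      by (simp add: power_mult_distrib[symmetric] complex_norm_square[symmetric] mult.commute)
    have "cnj (a * z ^ m) * (b * z ^ n) = cnj a * b * (cnj z ^ m * z ^ m) * z ^ (n - m)"
      using le by (simp add: mult_ac power_add[symmetric])
    then have "cnj (a * z ^ m) * (b * z ^ n) = cnj a * b * z ^ (n - m)"
      by (simp only: z mult_1_right)
    moreover have "Re v * Re w = Re (v * w) / 2 + Re (cnj v * w) / 2" for v w
      by (simp add: field_simps)
    ultimately have "Re (a * z ^ m) * Re (b * z ^ n) =
        Re (a * z ^ m * (b * z ^ n)) / 2 + Re (cnj a * b * z ^ (n - m)) / 2"
      by metis
    also have "\<dots> = Re (a * b / 2 * z ^ (m + n) + cnj a * b / 2 * z ^ (n - m))"
      by (simp add: power_add mult_ac add_divide_distrib del: times_complex.sel)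
    finally show "Re (poly (monom a m) z) * Re (poly (monom b n) z) =
        Re (poly (monom (a * b / 2) (m + n) + monom (cnj a * b / 2) (n - m)) z)"
      by (simp only: poly_add poly_monom)
  qed
next
  case (sym m n)
  then show ?case by (metis mult.commute)
qed

lemma Re_poly_mult_on_circle:
  fixes p q :: "complex poly"
  shows "\<exists>r. \<forall>z\<in>sphere 0 1. Re (poly p z) * Re (poly q z) = Re (poly r z)"
proof -
  \<comment> \<open>\<open>R\<close> is a choice function, so that the polynomial does not depend on
    the point \<open>z\<close>.\<close>
  obtain R where R: "\<And>a m b n z. z \<in> sphere 0 1 \<Longrightarrow>
      Re (poly (monom a m) z) * Re (poly (monom b n) z) = Re (poly (R a m b n) z)"
    using Re_monom_mult_on_circle by metis
  show ?thesis
  proof (intro exI ballI)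
    fix z :: complex assume z: "z \<in> sphere 0 1"
    have "Re (poly p z) * Re (poly q z) =
        (\<Sum>i\<le>degree p. \<Sum>j\<le>degree q. Re (poly (monom (coeff p i) i) z) * Re (poly (monom (coeff q j) j) z))"
      unfolding poly_altdef[of p] poly_altdef[of q] poly_monom Re_sum sum_product ..
    also have "\<dots> = Re (poly (\<Sum>i\<le>degree p. \<Sum>j\<le>degree q. R (coeff p i) i (coeff q j) j) z)"
      by (simp only: R[OF z] poly_sum Re_sum)
    finally show "Re (poly p z) * Re (poly q z) =
        Re (poly (\<Sum>i\<le>degree p. \<Sum>j\<le>degree q. R (coeff p i) i (coeff q j) j) z)" .
  qed
qed

text \<open>The real parts of complex polynomials, restricted to the circle, form an algebra
  containing the constants and the real-linear functions.\<close>

lemma real_polynomial_function_on_circle: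
  assumes "real_polynomial_function g"
  shows "\<exists>p. \<forall>z\<in>sphere (0::complex) 1. g z = Re (poly p z)"
  using assms
proof induction
  case (linear f)
  then interpret bounded_linear f .
  have "f z = Re (poly [:0, Complex (f 1) (- f \<i>):] z)" for z
  proof -
    have "z = Re z *\<^sub>R 1 + Im z *\<^sub>R \<i>"
      by (simp add: complex_eq_iff)
    then have "f z = f (Re z *\<^sub>R 1 + Im z *\<^sub>R \<i>)"
      by (rule arg_cong)
    also have "\<dots> = Re z * f 1 + Im z * f \<i>"
      by (simp only: add scaleR real_scaleR_def)
    finally show ?thesis by simp
  qed
  then show ?case by blast
next
  case (const c)
  show ?case by (rule exI[of _ "[:of_real c:]"]) simp
next
  case (add f g)
  then obtain p q where "\<forall>z\<in>sphere 0 1. f z = Re (poly p z)" "\<forall>z\<in>sphere 0 1. g z = Re (poly q z)"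
    by blast
  then show ?case by (intro exI[of _ "p + q"]) simp
next
  case (mult f g)
  then show ?case using Re_poly_mult_on_circle by metis
qed

text \<open>Stone-Weierstrass. The approximant extends to the disc as the real part of a holomorphic
  function, which replaces the Poisson integral of \<open>\<phi>\<close>.\<close>

lemma continuous_on_circle_approx_Re_poly:
  fixes \<phi> :: "complex \<Rightarrow> real"
  assumes "continuous_on (sphere 0 1) \<phi>" "e > 0"
  obtains p where "\<And>z. z \<in> sphere 0 1 \<Longrightarrow> \<bar>\<phi> z - Re (poly p z)\<bar> < e"
proof -
  obtain g where "real_polynomial_function g" "\<And>z. z \<in> sphere 0 1 \<Longrightarrow> \<bar>\<phi> z - g z\<bar> < e"
    using Stone_Weierstrass_real_polynomial_function[OF compact_sphere assms] by metis
  with real_polynomial_function_on_circle that show ?thesis by metis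
qed

section \<open>Integration over the circle\<close>

lemma cis_measurable_circle:
  "cis \<in> uniform_measure lborel {0..<2*pi} \<rightarrow>\<^sub>M restrict_space borel (sphere 0 1)"
proof (rule measurable_restrict_space2)
  have "cis \<in> borel_measurable borel"
    by (intro borel_measurable_continuous_onI continuous_intros)
  then show "cis \<in> borel_measurable (uniform_measure lborel {0..<2*pi})"
    by simp
qed auto

lemma space_circle_measure [simp]: "space circle_measure = sphere 0 1"
  by (simp add: circle_measure_def space_restrict_space)

lemma sets_circle_measure [measurable_cong]:
  "sets circle_measure = sets (restrict_space borel (sphere 0 1))"
  by (simp add: circle_measure_def)

lemma prob_space_circle_measure: "prob_space circle_measure"
  unfolding circle_measure_def
  by (intro prob_space.prob_space_distr prob_space_uniform_measure cis_measurable_circle) auto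

lemma continuous_on_imp_measurable_circle:
  "continuous_on (sphere 0 1) f \<Longrightarrow> f \<in> borel_measurable circle_measure"
  using borel_measurable_continuous_on_restrict measurable_cong_sets sets_circle_measure by blast

lemma continuous_on_imp_integrable_circle:
  fixes f :: "complex \<Rightarrow> 'b::{banach, second_countable_topology}"
  assumes "continuous_on (sphere 0 1) f"
  shows "integrable circle_measure f"
proof -
  interpret prob_space circle_measure by (rule prob_space_circle_measure)
  have "bounded (f ` sphere 0 1)"
    by (intro compact_imp_bounded compact_continuous_image assms compact_sphere)
  then obtain B where "\<And>z. z \<in> sphere 0 1 \<Longrightarrow> norm (f z) \<le> B"
    unfolding bounded_iff by blast
  then show ?thesis
    by (intro integrable_const_bound[of _ B] continuous_on_imp_measurable_circle assms) auto
qed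

lemma circle_measure_integral_power:
  assumes "n > 0"
  shows "(\<integral>z. z ^ n \<partial>circle_measure) = 0"
proof -
  have "(\<integral>z. z ^ n \<partial>circle_measure) = (\<integral>t. cis t ^ n \<partial>uniform_measure lborel {0..<2*pi})"
    unfolding circle_measure_def
    by (intro integral_distr cis_measurable_circle borel_measurable_continuous_on_restrict continuous_intros)
  also have "\<dots> = (\<integral>t. (indicator {0..<2*pi} t / (2*pi)) *\<^sub>R cis t ^ n \<partial>lborel)"
  proof -
    have "uniform_measure lborel {0..<2*pi} = density lborel (\<lambda>t. ennreal (indicator {0..<2*pi} t / (2*pi)))"
      unfolding uniform_measure_def
      by (intro density_cong) (auto simp: divide_ennreal[symmetric] ennreal_indicator)
    moreover have "(\<lambda>t. cis t ^ n) \<in> borel_measurable lborel"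
      by (simp, intro borel_measurable_continuous_onI continuous_intros)
    ultimately show ?thesis
      by (simp add: integral_density)
  qed
  \<comment> \<open>Adding the null set \<open>{2*pi}\<close> gives the closed interval required by
    the fundamental theorem of calculus.\<close>
  also have "\<dots> = (\<integral>t. indicator {0..2*pi} t *\<^sub>R (cis t ^ n / (2*pi)) \<partial>lborel)"
  proof (rule integral_cong_AE)
    have [measurable]: "(\<lambda>t. cis t ^ n) \<in> borel_measurable borel"
      by (intro borel_measurable_continuous_onI continuous_intros)
    show "(\<lambda>t. (indicator {0..<2*pi} t / (2*pi)) *\<^sub>R cis t ^ n) \<in> borel_measurable lborel"
      "(\<lambda>t. indicator {0..2*pi} t *\<^sub>R (cis t ^ n / (2*pi))) \<in> borel_measurable lborel"
      by measurable
    show "AE t in lborel. (indicator {0..<2*pi} t / (2*pi)) *\<^sub>R cis t ^ n =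
        indicator {0..2*pi} t *\<^sub>R (cis t ^ n / (2*pi))"
      by (rule AE_I'[of "{2*pi}"]) (auto simp: scaleR_conv_of_real indicator_def)
  qed
  \<comment> \<open>The antiderivative is periodic, so its boundary values cancel;
    \<open>n > 0\<close> makes its denominator nonzero.\<close>
  also have "\<dots> = cis (real n * (2*pi)) / (2*pi*\<i>*n) - cis (real n * 0) / (2*pi*\<i>*n)"
  proof (rule integral_FTC_Icc)
    fix t :: real
    have "((\<lambda>w. exp (\<i> * n * w) / (2*pi*\<i>*n)) has_field_derivative exp (\<i> * n * of_real t) / (2*pi))
        (at (of_real t))"
      using assms by (auto intro!: derivative_eq_intros)
    moreover have "exp (\<i> * n * of_real x) = cis (real n * x)" for x
      by (simp add: cis_conv_exp mult.assoc)
    ultimately show "((\<lambda>t. cis (real n * t) / (2*pi*\<i>*n)) has_vector_derivative cis t ^ n / (2*pi)) (at t within {0..2*pi})"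
      using has_vector_derivative_real_field[of "\<lambda>w. exp (\<i> * n * w) / (2*pi*\<i>*n)"]
      by (simp add: Complex.DeMoivre)
  qed (auto intro!: continuous_intros)
  also have "\<dots> = 0"
    by (metis Complex.DeMoivre cancel_comm_monoid_add_class.diff_cancel cis_2pi cis_zero mult_zero_right power_one)
  finally show ?thesis .
qed

text \<open>All powers but the constant one integrate to 0.\<close>

lemma circle_measure_integral_poly:
  "(\<integral>z. poly p z \<partial>circle_measure) = poly p 0"
proof -
  interpret prob_space circle_measure by (rule prob_space_circle_measure)
  have int: "integrable circle_measure (\<lambda>z. coeff p i * z ^ i)" for i
    by (intro continuous_on_imp_integrable_circle continuous_intros)
  have "(\<integral>z. poly p z \<partial>circle_measure) = (\<Sum>i\<le>degree p. \<integral>z. coeff p i * z ^ i \<partial>circle_measure)"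
    by (simp add: poly_altdef Bochner_Integration.integral_sum int)
  also have "\<dots> = (\<Sum>i\<le>degree p. if i = 0 then coeff p 0 else 0)"
    using prob_space by (intro sum.cong) (auto simp: circle_measure_integral_power)
  also have "\<dots> = poly p 0"
    by (simp add: poly_0_coeff_0)
  finally show ?thesis .
qed

lemma circle_measure_integral_Re_poly:
  "(\<integral>z. Re (poly p z) \<partial>circle_measure) = Re (poly p 0)"
  by (subst integral_Re)
     (auto simp: circle_measure_integral_poly intro!: continuous_on_imp_integrable_circle continuous_intros)

section \<open>Mean value inequality for the truncated logarithm\<close>

text \<open>For \<open>e > 0\<close> the truncation keeps the logarithm of the modulus continuous
  and bounded below at zeros of a function.\<close>

definition trunc_ln :: "real \<Rightarrow> complex \<Rightarrow> real" where
  "trunc_ln e w = ln (max (norm w) e)"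

text \<open>The constant is the minimum over the circle of the Poisson kernel at \<open>a\<close>;
  since the logarithm is non-positive on the circle, replacing the kernel by its minimum can only
  increase the integral.\<close>

lemma trunc_ln_circle_mean:
  assumes "continuous_on (cball 0 1) u" "u holomorphic_on ball 0 1"
    and "\<And>z. z \<in> sphere 0 1 \<Longrightarrow> norm (u z) \<le> 1" "0 < e" "e \<le> 1" "norm a < 1"
  shows "trunc_ln e (u a) \<le> (1 - norm a) / (1 + norm a) * (\<integral>z. trunc_ln e (u z) \<partial>circle_measure)"
proof (rule field_le_epsilon)
  fix \<eta>0 :: real assume "\<eta>0 > 0"
  define \<eta> where "\<eta> = \<eta>0 / 4"
  have \<eta>: "\<eta> > 0" using \<open>\<eta>0 > 0\<close> by (simp add: \<eta>_def)
  interpret prob_space circle_measure by (rule prob_space_circle_measure)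
  have pos: "max (norm w) e > 0" for w :: complex
    using \<open>0 < e\<close> by (simp add: less_max_iff_disj)
  have cont: "continuous_on (sphere 0 1) (\<lambda>z. trunc_ln e (u z))"
    unfolding trunc_ln_def using pos
    by (intro continuous_intros continuous_on_subset[OF assms(1)]) (auto simp: less_imp_neq[symmetric])
  obtain p where p: "\<And>z. z \<in> sphere 0 1 \<Longrightarrow> \<bar>trunc_ln e (u z) - Re (poly p z)\<bar> < \<eta>"
    using continuous_on_circle_approx_Re_poly[OF cont \<eta>] by metis
  \<comment> \<open>Used for \<open>v = u\<close> and for the constant \<open>v = e\<close>;
    together they bound \<open>max (norm (u a)) e\<close>.\<close>
  have max_le: "norm (v a * exp (- poly p a)) \<le> exp \<eta>"
    if "continuous_on (cball 0 1) v" "v holomorphic_on ball 0 1"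
      "\<And>z. z \<in> sphere 0 1 \<Longrightarrow> norm (v z) \<le> max (norm (u z)) e" for v
  proof (rule maximum_modulus_frontier[of "\<lambda>z. v z * exp (- poly p z)" "cball 0 1"])
    fix z :: complex assume "z \<in> frontier (cball 0 1)"
    then have z: "z \<in> sphere 0 1" by simp
    have "norm (v z * exp (- poly p z)) \<le> max (norm (u z)) e * exp (- Re (poly p z))"
      by (simp add: norm_mult that(3)[OF z])
    also have "\<dots> = exp (trunc_ln e (u z) - Re (poly p z))"
      using pos[of "u z"] by (simp add: trunc_ln_def exp_diff exp_minus field_simps)
    also have "\<dots> \<le> exp \<eta>"
      using p[OF z] by simp
    finally show "norm (v z * exp (- poly p z)) \<le> exp \<eta>" .
  qed (use that assms(6) in \<open>auto intro!: holomorphic_intros continuous_intros\<close>)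
  have "norm (u a) * exp (- Re (poly p a)) \<le> exp \<eta>"
    using max_le[OF assms(1,2)] by (simp add: norm_mult)
  moreover have "e * exp (- Re (poly p a)) \<le> exp \<eta>"
    using max_le[of "\<lambda>_. of_real e"] \<open>0 < e\<close> by (simp add: norm_mult)
  ultimately have "max (norm (u a)) e * exp (- Re (poly p a)) \<le> exp \<eta>"
    by (simp add: max_def)
  then have "ln (max (norm (u a)) e * exp (- Re (poly p a))) \<le> \<eta>"
    using pos[of "u a"] by (subst ln_le_cancel_iff[of _ "exp \<eta>", simplified]) auto
  then have "trunc_ln e (u a) - Re (poly p a) \<le> \<eta>"
    using pos[of "u a"] by (simp add: trunc_ln_def ln_mult)
  \<comment> \<open>Harnack needs a positive function. On the disc \<open>Re p \<le> \<eta>\<close>,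
    so \<open>2 \<eta> - Re p\<close> is one.\<close>
  moreover have "(1 - norm a) / (1 + norm a) * Re (of_real (2*\<eta>) - poly p 0) \<le> Re (of_real (2*\<eta>) - poly p a)"
  proof (rule Harnack_lower_bound[of "\<lambda>z. of_real (2*\<eta>) - poly p z"])
    fix z :: complex assume z: "norm z < 1"
    \<comment> \<open>The maximum principle for \<open>exp p\<close> carries the bound
      \<open>Re p \<le> \<eta>\<close> from the circle into the disc.\<close>
    have "norm (exp (poly p z)) \<le> exp \<eta>"
    proof (rule maximum_modulus_frontier[of "\<lambda>z. exp (poly p z)" "cball 0 1"])
      fix z :: complex assume "z \<in> frontier (cball 0 1)"
      then have z: "z \<in> sphere 0 1" by simp
      have "trunc_ln e (u z) \<le> 0"
        using pos[of "u z"] assms(3)[OF z] assms(5) by (simp add: trunc_ln_def ln_le_zero_iff)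
      then show "norm (exp (poly p z)) \<le> exp \<eta>"
        using p[OF z] by simp
    qed (use z in \<open>auto intro!: holomorphic_intros continuous_intros\<close>)
    then show "Re (of_real (2*\<eta>) - poly p z) > 0"
      using \<eta> by simp
  qed (use assms(6) in \<open>auto intro!: holomorphic_intros\<close>)
  moreover have "Re (poly p 0) \<le> (\<integral>z. trunc_ln e (u z) \<partial>circle_measure) + \<eta>"
  proof -
    have "(\<integral>z. Re (poly p z) \<partial>circle_measure) \<le> (\<integral>z. trunc_ln e (u z) + \<eta> \<partial>circle_measure)"
      using p by (intro integral_mono continuous_on_imp_integrable_circle continuous_intros cont)
        (auto simp: abs_less_iff algebra_simps less_imp_le)
    then show ?thesis
      using prob_space
      by (simp add: circle_measure_integral_Re_poly continuous_on_imp_integrable_circle cont)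
  qed
  moreover define c where "c = (1 - norm a) / (1 + norm a)"
  moreover have c: "c \<ge> 0" "c \<le> 1"
    using assms(6) by (auto simp: c_def divide_simps add_pos_nonneg)
  \<comment> \<open>The errors add up to \<open>3 \<eta> - c \<eta>\<close>, which is below
    \<open>\<eta>0 = 4 \<eta>\<close>.\<close>
  ultimately have "trunc_ln e (u a) \<le> 3 * \<eta> - c * (2 * \<eta> - Re (poly p 0))"
      and "c * Re (poly p 0) \<le> c * ((\<integral>z. trunc_ln e (u z) \<partial>circle_measure) + \<eta>)"
    subgoal by simp
    by (rule mult_left_mono) fact+
  then have "trunc_ln e (u a) \<le> c * (\<integral>z. trunc_ln e (u z) \<partial>circle_measure) + (3 * \<eta> - c * \<eta>)"
    by (simp add: algebra_simps)
  also have "\<dots> \<le> c * (\<integral>z. trunc_ln e (u z) \<partial>circle_measure) + \<eta>0"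
    using mult_nonneg_nonneg[OF c(1), of \<eta>] \<eta> by (simp add: \<eta>_def)
  finally show "trunc_ln e (u a) \<le>
      (1 - norm a) / (1 + norm a) * (\<integral>z. trunc_ln e (u z) \<partial>circle_measure) + \<eta>0"
    by (simp add: c_def)
qed

subsection \<open>Continuous functions on the polydisc\<close>

lemma topspace_polydisc_top [simp]: "topspace (polydisc_top I) = polydisc I"
  by (simp add: polydisc_top_def polydisc_def)

lemma space_torus_measure: "space (PiM I (\<lambda>_. circle_measure)) = torus I"
  by (simp add: space_PiM torus_def)

lemma torus_subset_polydisc: "torus I \<subseteq> polydisc I"
  unfolding torus_def polydisc_def by (intro PiE_mono sphere_cball)

lemma compact_space_polydisc_top: "compact_space (polydisc_top I)"
  by (simp add: polydisc_top_def compact_space_product_topology compact_space_subtopology)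

text \<open>Freezing the coordinates outside \<open>F\<close> at those of \<open>a\<close> turns a
  function on the polydisc into one of the variables in \<open>F\<close>.\<close>

lemma merge_in_polydisc:
  assumes "F \<subseteq> I" "x \<in> polydisc F" "a \<in> polydisc I"
  shows "merge F (I - F) (x, a) \<in> polydisc I"
  using assms by (auto simp: polydisc_def merge_def PiE_iff extensional_def)

lemma merge_update_insert:
  assumes "F \<subseteq> I" "i \<in> I" "i \<notin> F"
  shows "merge (insert i F) (I - insert i F) (x(i := w), a) = (merge F (I - F) (x, a))(i := w)"
  using assms by (auto simp: merge_def fun_eq_iff)

text \<open>A basic open box constrains only finitely many coordinates; this is the source of the
  reduction to finitely many variables.\<close>

lemma polydisc_continuous_nbhd:
  assumes "continuous_map (polydisc_top I) euclidean h" "open V" "z \<in> polydisc I" "h z \<in> V"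
  shows "\<exists>U. finite {i \<in> I. U i \<noteq> cball 0 1} \<and> (\<forall>i\<in>I. openin (top_of_set (cball 0 1)) (U i)) \<and>
    z \<in> PiE I U \<and> (\<forall>w\<in>PiE I U. h w \<in> V)"
proof -
  have "openin (polydisc_top I) {z \<in> polydisc I. h z \<in> V}"
    using openin_continuous_map_preimage[OF assms(1), of V] assms(2) by simp
  moreover have "z \<in> {z \<in> polydisc I. h z \<in> V}"
    using assms by simp
  ultimately have "\<exists>U. finite {i \<in> I. U i \<noteq> topspace (top_of_set (cball 0 1))} \<and>
      (\<forall>i\<in>I. openin (top_of_set (cball 0 1)) (U i)) \<and> z \<in> PiE I U \<and> PiE I U \<subseteq> {z \<in> polydisc I. h z \<in> V}"
    unfolding polydisc_top_def openin_product_topology_alt by (rule bspec)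
  then show ?thesis
    by (elim ex_forward) auto
qed

text \<open>By compactness finitely many boxes, on each of which \<open>h\<close> stays within
  \<open>e/2\<close> of its value at a centre, cover the polydisc. Coordinates that none of them
  constrains can be changed without leaving a box. \<open>F0\<close> allows a prescribed finite set
  to be included in \<open>F\<close>.\<close>

lemma polydisc_finite_dependence:
  fixes h :: "('i \<Rightarrow> complex) \<Rightarrow> complex"
  assumes "continuous_map (polydisc_top I) euclidean h" "e > 0" "finite F0" "F0 \<subseteq> I"
  obtains F where "finite F" "F0 \<subseteq> F" "F \<subseteq> I"
    "\<And>z a. z \<in> polydisc I \<Longrightarrow> a \<in> polydisc I \<Longrightarrow> dist (h (merge F (I - F) (z, a))) (h z) < e"
proof -
  define good where "good z U \<longleftrightarrow> finite {i \<in> I. U i \<noteq> cball 0 1} \<and>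
      (\<forall>i\<in>I. openin (top_of_set (cball 0 1)) (U i)) \<and> z \<in> PiE I U \<and>
      (\<forall>w\<in>PiE I U. h w \<in> ball (h z) (e/2))" for z and U :: "'i \<Rightarrow> complex set"
  have "\<exists>U. good z U" if "z \<in> polydisc I" for z
    unfolding good_def by (rule polydisc_continuous_nbhd[OF assms(1) open_ball that]) (use \<open>e > 0\<close> in simp)
  then obtain U where U: "\<And>z. z \<in> polydisc I \<Longrightarrow> good z (U z)"
    by metis
  have op: "openin (polydisc_top I) (PiE I (U z))" if "z \<in> polydisc I" for z
    using U[OF that] unfolding polydisc_top_def good_def by (auto simp: openin_PiE_gen)
  have "compactin (polydisc_top I) (polydisc I)"
    using compact_space_polydisc_top[of I] by (simp add: compact_space_def)
  moreover have "\<forall>W\<in>(\<lambda>z. PiE I (U z)) ` polydisc I. openin (polydisc_top I) W"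
    using op by blast
  moreover have "polydisc I \<subseteq> \<Union>((\<lambda>z. PiE I (U z)) ` polydisc I)"
    using U unfolding good_def by blast
  ultimately obtain \<F> where "finite \<F>" "\<F> \<subseteq> (\<lambda>z. PiE I (U z)) ` polydisc I" "polydisc I \<subseteq> \<Union>\<F>"
    unfolding compactin_def by metis
  then obtain Z where Z: "finite Z" "Z \<subseteq> polydisc I" "polydisc I \<subseteq> (\<Union>z\<in>Z. PiE I (U z))"
    by (metis finite_subset_image)
  define F where "F = F0 \<union> (\<Union>z\<in>Z. {i \<in> I. U z i \<noteq> cball 0 1})"
  show thesis
  proof
    show "finite F"
      using Z U assms(3) unfolding F_def good_def by (auto simp: subset_iff)
    show "F0 \<subseteq> F" "F \<subseteq> I"
      using assms(4) by (auto simp: F_def)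
    fix z a assume za: "z \<in> polydisc I" "a \<in> polydisc I"
    then obtain y where y: "y \<in> Z" "z \<in> PiE I (U y)"
      using Z by blast
    \<comment> \<open>Outside \<open>F\<close> every factor of the box is the whole closed
      disc.\<close>
    then have "merge F (I - F) (z, a) \<in> PiE I (U y)"
      using za(2) by (auto simp: PiE_iff merge_def extensional_def F_def polydisc_def)
    then have "h (merge F (I - F) (z, a)) \<in> ball (h y) (e/2)" "h z \<in> ball (h y) (e/2)"
      using y U Z(2) unfolding good_def by blast+
    then show "dist (h (merge F (I - F) (z, a))) (h z) < e"
      by (simp add: dist_triangle_half_l dist_commute)
  qed
qed

text \<open>Points of the open polydisc with finite support are dense.\<close>

lemma polydisc_zero_if_zero_on_finite_support:
  fixes h :: "('i \<Rightarrow> complex) \<Rightarrow> complex"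
  assumes "continuous_map (polydisc_top I) euclidean h"
    and "\<And>a. a \<in> PiE I (\<lambda>_. ball 0 1) \<Longrightarrow> finite {i \<in> I. a i \<noteq> 0} \<Longrightarrow> h a = 0"
    and "z \<in> polydisc I"
  shows "h z = 0"
proof (rule ccontr)
  assume "h z \<noteq> 0"
  then have hz: "h z \<in> -{0}" by simp
  obtain U where U: "finite {i \<in> I. U i \<noteq> cball 0 1}"
      "\<And>i. i \<in> I \<Longrightarrow> openin (top_of_set (cball 0 1)) (U i)" "z \<in> PiE I U"
      "\<And>w. w \<in> PiE I U \<Longrightarrow> h w \<in> -{0}"
    using polydisc_continuous_nbhd[OF assms(1) open_Compl[OF closed_singleton] assms(3) hz] by blast
  \<comment> \<open>The closed disc is the closure of the open one, so a relatively open set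
    containing \<open>z i\<close> meets the open disc.\<close>
  have "\<exists>b. b \<in> U i \<inter> ball 0 1" if i: "i \<in> I" for i
  proof -
    obtain W where W: "open W" "U i = cball 0 1 \<inter> W"
      using U(2)[OF i] by (auto simp: openin_open)
    moreover have "z i \<in> W \<inter> closure (ball 0 1)"
      using U(3) W i by (auto simp: PiE_iff)
    ultimately have "W \<inter> ball 0 1 \<noteq> {}"
      using open_Int_closure_eq_empty[of W "ball 0 1"] by blast
    then obtain b where "b \<in> W" "b \<in> ball 0 1"
      by blast
    moreover from this have "b \<in> cball 0 1"
      using ball_subset_cball by blast
    ultimately show ?thesis
      using W(2) by blast
  qed
  then obtain b where b: "\<And>i. i \<in> I \<Longrightarrow> b i \<in> U i \<inter> ball 0 1"
    by metis
  \<comment> \<open>Coordinates on which the box imposes nothing are set to 0, which makes the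
    support finite.\<close>
  define a where "a = (\<lambda>i\<in>I. if U i = cball 0 1 then 0 else b i)"
  have "finite {i \<in> I. a i \<noteq> 0}"
    by (rule finite_subset[OF _ U(1)]) (auto simp: a_def)
  moreover have "a \<in> PiE I (\<lambda>_. ball 0 1)" "a \<in> PiE I U"
    using b by (auto simp: a_def)
  ultimately show False
    using assms(2) U(4) by blast
qed

section \<open>Measurability of continuous functions of finitely many coordinates\<close>

text \<open>The discretised point takes finitely many values, each on a measurable rectangle, so its
  composition with any \<open>g\<close> is measurable.\<close>

lemma circle_coordinatewise_simple_measurable:
  assumes "finite F" "simple_function circle_measure s"
  shows "(\<lambda>x. g (restrict (\<lambda>i. s (x i)) F)) \<in> borel_measurable (PiM F (\<lambda>_. circle_measure))"
proof -
  let ?R = "PiE F (\<lambda>_. s ` sphere 0 1)"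
  have R: "finite ?R"
    using assms simple_functionD(1)[OF assms(2)] by (intro finite_PiE) auto
  have "(\<lambda>x. restrict (\<lambda>i. s (x i)) F) \<in> PiM F (\<lambda>_. circle_measure) \<rightarrow>\<^sub>M count_space ?R"
    unfolding measurable_count_space_eq2[OF R]
  proof (intro conjI ballI)
    show "(\<lambda>x. restrict (\<lambda>i. s (x i)) F) \<in> space (PiM F (\<lambda>_. circle_measure)) \<rightarrow> ?R"
      by (auto simp: space_PiM)
    fix r assume r: "r \<in> ?R"
    have "(\<lambda>x. restrict (\<lambda>i. s (x i)) F) -` {r} \<inter> space (PiM F (\<lambda>_. circle_measure)) =
        PiE F (\<lambda>i. s -` {r i} \<inter> space circle_measure)"
      using r by (auto simp: space_PiM PiE_iff fun_eq_iff extensional_def restrict_def)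
    also have "\<dots> \<in> sets (PiM F (\<lambda>_. circle_measure))"
      using assms by (intro sets_PiM_I_finite) (use simple_functionD(2)[OF assms(2)] in auto)
    finally show "(\<lambda>x. restrict (\<lambda>i. s (x i)) F) -` {r} \<inter> space (PiM F (\<lambda>_. circle_measure))
        \<in> sets (PiM F (\<lambda>_. circle_measure))" .
  qed
  then show ?thesis
    by (rule measurable_compose) simp
qed

text \<open>The product measure lives on the product of the Borel sets, so measurability of a jointly
  continuous function is obtained by discretising each of the finitely many coordinates.\<close>

lemma polydisc_continuous_measurable:
  fixes h :: "('i \<Rightarrow> complex) \<Rightarrow> complex"
  assumes "continuous_map (polydisc_top I) euclidean h" "finite F" "F \<subseteq> I" "a \<in> polydisc I"
  shows "(\<lambda>x. h (merge F (I - F) (x, a))) \<in> borel_measurable (PiM F (\<lambda>_. circle_measure))"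
proof -
  \<comment> \<open>The simple approximations of the identity may leave the closed disc, where
    \<open>h\<close> is not controlled. This continuous retraction brings them back and fixes the
    circle, so limits are kept.\<close>
  define clamp :: "complex \<Rightarrow> complex" where "clamp w = w /\<^sub>R max 1 (norm w)" for w
  have clamp_cont: "continuous_on UNIV clamp"
    unfolding clamp_def by (intro continuous_intros) (auto simp: max_def)
  have clamp_le: "norm (clamp w) \<le> 1" for w
    by (simp add: clamp_def divide_simps max_def)
  have clamp_id: "clamp w = w" if "w \<in> sphere 0 1" for w
    using that by (simp add: clamp_def)
  have "(\<lambda>w. w) \<in> borel_measurable circle_measure"
    by (intro continuous_on_imp_measurable_circle continuous_intros)
  from borel_measurable_implies_sequence_metric[OF this, of 0]
  obtain r where r: "\<And>n. simple_function circle_measure (r n)"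
      "\<And>w. w \<in> sphere 0 1 \<Longrightarrow> (\<lambda>n. r n w) \<longlonglongrightarrow> w"
    unfolding space_circle_measure by blast
  define s where "s n = clamp \<circ> r n" for n
  have s: "simple_function circle_measure (s n)" for n
    unfolding s_def by (rule simple_function_compose[OF r(1)])
  have lim: "(\<lambda>n. s n w) \<longlonglongrightarrow> w" if "w \<in> sphere 0 1" for w
    using continuous_on_tendsto_compose[OF clamp_cont r(2)[OF that]] clamp_id[OF that]
    by (simp add: s_def)
  have s_le: "norm (s n w) \<le> 1" for n w
    by (simp add: s_def clamp_le)
  show ?thesis
  proof (rule borel_measurable_LIMSEQ_metric)
    show "(\<lambda>x. h (merge F (I - F) (restrict (\<lambda>i. s n (x i)) F, a))) \<in> borel_measurable (PiM F (\<lambda>_. circle_measure))" for n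
      by (rule circle_coordinatewise_simple_measurable[OF assms(2) s])
    fix x assume "x \<in> space (PiM F (\<lambda>_. circle_measure))"
    then have x: "x i \<in> sphere 0 1" if "i \<in> F" for i
      using that by (auto simp: space_PiM)
    \<comment> \<open>Convergence is coordinatewise: the coordinates in \<open>F\<close> converge by
      \<open>lim\<close>, the others are constant.\<close>
    have "limitin (polydisc_top I) (\<lambda>n. merge F (I - F) (restrict (\<lambda>i. s n (x i)) F, a))
        (merge F (I - F) (x, a)) sequentially"
      unfolding polydisc_top_def limitin_componentwise
    proof (intro conjI ballI)
      show "merge F (I - F) (x, a) \<in> extensional I"
        using assms(3) by (auto simp: merge_def extensional_def)
      show "\<forall>\<^sub>F n in sequentially. merge F (I - F) (restrict (\<lambda>i. s n (x i)) F, a)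
          \<in> topspace (product_topology (\<lambda>_. top_of_set (cball 0 1)) I)"
      proof (intro always_eventually allI)
        fix n
        have "restrict (\<lambda>i. s n (x i)) F \<in> polydisc F"
          using s_le by (simp add: polydisc_def)
        from merge_in_polydisc[OF assms(3) this assms(4)]
        show "merge F (I - F) (restrict (\<lambda>i. s n (x i)) F, a) \<in> topspace (product_topology (\<lambda>_. top_of_set (cball 0 1)) I)"
          by (simp only: topspace_polydisc_top[unfolded polydisc_top_def])
      qed
      fix i assume i: "i \<in> I"
      show "limitin (top_of_set (cball 0 1)) (\<lambda>n. merge F (I - F) (restrict (\<lambda>i. s n (x i)) F, a) i)
          (merge F (I - F) (x, a) i) sequentially"
      proof (cases "i \<in> F")
        case True
        then show ?thesis
          using x[OF True] lim[OF x[OF True]] s_le by (simp add: limitin_subtopology)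
      next
        case False
        then show ?thesis
          using i assms(4) by (auto simp: polydisc_def)
      qed
    qed
    from continuous_map_limit[OF assms(1) this]
    show "(\<lambda>n. h (merge F (I - F) (restrict (\<lambda>i. s n (x i)) F, a))) \<longlonglongrightarrow> h (merge F (I - F) (x, a))"
      by (simp add: o_def)
  qed
qed

subsection \<open>The mean value inequality on the polydisc and uniqueness\<close>

interpretation circle: product_prob_space "\<lambda>_. circle_measure" I for I
proof -
  interpret prob_space circle_measure by (rule prob_space_circle_measure)
  show "product_prob_space (\<lambda>_. circle_measure)"
    by unfold_locales
qed

lemma polydisc_algebra_update:
  assumes "h \<in> polydisc_algebra I" "z \<in> polydisc I" "i \<in> I"
  shows "continuous_on (cball 0 1) (\<lambda>w. h (z(i := w)))" "(\<lambda>w. h (z(i := w))) holomorphic_on ball 0 1"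
  using assms by (auto simp: polydisc_algebra_def)

lemma polydisc_update:
  "z \<in> polydisc I \<Longrightarrow> i \<in> I \<Longrightarrow> norm w \<le> 1 \<Longrightarrow> z(i := w) \<in> polydisc I"
  by (auto simp: polydisc_def PiE_iff extensional_def)

lemma trunc_ln_bounds:
  assumes "0 < e" "e \<le> 1" "norm w \<le> 1"
  shows "ln e \<le> trunc_ln e w" "trunc_ln e w \<le> 0"
  using assms by (auto simp: trunc_ln_def less_max_iff_disj ln_le_zero_iff)

lemma measurable_trunc_ln [measurable]: "trunc_ln e \<in> borel_measurable borel"
  unfolding trunc_ln_def by measurable

text \<open>Induction on \<open>F\<close>: the one-variable inequality in a new coordinate
  \<open>i\<close> contributes the factor for \<open>a i\<close>, and Fubini combines the
  integrals.\<close>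

lemma trunc_ln_polydisc_mean:
  fixes h :: "('i \<Rightarrow> complex) \<Rightarrow> complex"
  assumes h: "h \<in> polydisc_algebra I" "\<And>z. z \<in> polydisc I \<Longrightarrow> norm (h z) \<le> 1"
    and e: "0 < e" "e \<le> 1" and a: "a \<in> PiE I (\<lambda>_. ball 0 1)"
    and F: "finite F" "F \<subseteq> I"
  shows "trunc_ln e (h a) \<le> (\<Prod>i\<in>F. (1 - norm (a i)) / (1 + norm (a i))) *
    (\<integral>x. trunc_ln e (h (merge F (I - F) (x, a))) \<partial>PiM F (\<lambda>_. circle_measure))"
proof -
  define \<phi> where "\<phi> F x = trunc_ln e (h (merge F (I - F) (x, a)))" for F x
  define c where "c i = (1 - norm (a i)) / (1 + norm (a i))" for i
  have c: "c i \<ge> 0" if "i \<in> I" for i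
    using a that by (auto simp: c_def PiE_iff intro!: divide_nonneg_nonneg)
  have a': "a \<in> polydisc I"
    using a ball_subset_cball unfolding polydisc_def PiE_iff by blast
  have cont: "continuous_map (polydisc_top I) euclidean h"
    using h(1) by (simp add: polydisc_algebra_def)
  have meas: "\<phi> F \<in> borel_measurable (PiM F (\<lambda>_. circle_measure))" if "finite F" "F \<subseteq> I" for F
    unfolding \<phi>_def
    by (rule measurable_compose[OF polydisc_continuous_measurable[OF cont that a'] measurable_trunc_ln])
  have in_polydisc: "merge F (I - F) (x, a) \<in> polydisc I" if "x \<in> torus F" "F \<subseteq> I" for F x
    using merge_in_polydisc[OF that(2) _ a'] torus_subset_polydisc that(1) by blast
  have bound: "norm (\<phi> F x) \<le> - ln e" if "x \<in> torus F" "F \<subseteq> I" for F x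
    using trunc_ln_bounds[OF e h(2)[OF in_polydisc[OF that]]] by (simp add: \<phi>_def)
  have int: "integrable (PiM F (\<lambda>_. circle_measure)) (\<phi> F)" if "finite F" "F \<subseteq> I" for F
    using bound[OF _ that(2)] meas[OF that]
    by (intro circle.P.integrable_const_bound[of _ "- ln e"]) (auto simp: space_torus_measure)
  have "trunc_ln e (h a) \<le> (\<Prod>i\<in>F. c i) * (\<integral>x. \<phi> F x \<partial>PiM F (\<lambda>_. circle_measure))"
    using F
  proof (induction F)
    case empty
    \<comment> \<open>With no free variables the integrand is constant on a probability
      space.\<close>
    have "merge {} I (x, a) = a" for x
      using a' by (auto simp: merge_def polydisc_def PiE_iff extensional_def fun_eq_iff)
    then show ?case
      using circle.P.prob_space[of "{} :: 'i set"] by (simp add: \<phi>_def del: circle.P.prob_space)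
  next
    case (insert i F)
    then have i: "i \<in> I" "F \<subseteq> I" "finite F" "i \<notin> F" by auto
    let ?F = "insert i F"
    have "\<phi> F x \<le> c i * (\<integral>w. \<phi> ?F (x(i := w)) \<partial>circle_measure)" if x: "x \<in> torus F" for x
    proof -
      define y where "y = merge F (I - F) (x, a)"
      have y: "y \<in> polydisc I"
        unfolding y_def by (rule in_polydisc[OF x i(2)])
      \<comment> \<open>Since \<open>i\<close> is not in \<open>F\<close>, this coordinate is still
        that of \<open>a\<close>, so the slice through \<open>y\<close> takes the value
        \<open>h y\<close> at \<open>a i\<close>.\<close>
      have yi: "y i = a i"
        using i by (simp add: y_def)
      have "norm (a i) < 1"
        using a i by (auto simp: PiE_iff)
      then have "trunc_ln e (h (y(i := a i))) \<le> c i * (\<integral>w. trunc_ln e (h (y(i := w))) \<partial>circle_measure)"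
        unfolding c_def using polydisc_algebra_update[OF h(1) y i(1)] e
        by (intro trunc_ln_circle_mean) (auto intro!: h(2) polydisc_update y i)
      moreover have "y(i := a i) = y"
        using yi by auto
      moreover have "merge ?F (I - ?F) (x(i := w), a) = y(i := w)" for w
        unfolding y_def by (rule merge_update_insert[OF i(2,1,4)])
      ultimately show ?thesis
        by (simp only: \<phi>_def y_def)
    qed
    \<comment> \<open>The partial integral is measurable and inherits the bound
      \<open>- ln e\<close>, so the pointwise inequality may be integrated.\<close>
    moreover have "integrable (PiM F (\<lambda>_. circle_measure)) (\<lambda>x. \<integral>w. \<phi> ?F (x(i := w)) \<partial>circle_measure)"
    proof (rule circle.P.integrable_const_bound[of _ "- ln e"])
      have [measurable]: "\<phi> ?F \<in> borel_measurable (PiM ?F (\<lambda>_. circle_measure))"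
        using insert.prems i by (intro meas) auto
      show "(\<lambda>x. \<integral>w. \<phi> ?F (x(i := w)) \<partial>circle_measure) \<in> borel_measurable (PiM F (\<lambda>_. circle_measure))"
        by measurable
      have "norm (\<integral>w. \<phi> ?F (x(i := w)) \<partial>circle_measure) \<le> - ln e" if x: "x \<in> torus F" for x
      proof -
        have b: "norm (\<phi> ?F (x(i := w))) \<le> - ln e" if "w \<in> sphere 0 1" for w
          using x that insert.prems by (intro bound) (auto simp: torus_def PiE_iff extensional_def)
        have "(\<lambda>w. \<phi> ?F (x(i := w))) \<in> borel_measurable circle_measure"
          using x
          by (intro measurable_compose[OF _ \<open>\<phi> ?F \<in> _\<close>] measurable_fun_upd[of _ F])
             (auto simp: space_torus_measure)
        then have int_w: "integrable circle_measure (\<lambda>w. \<phi> ?F (x(i := w)))"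
          using b by (intro circle.M.integrable_const_bound[of _ "- ln e"]) auto
        have "norm (\<integral>w. \<phi> ?F (x(i := w)) \<partial>circle_measure) \<le> (\<integral>w. norm (\<phi> ?F (x(i := w))) \<partial>circle_measure)"
          by (rule integral_norm_bound)
        also have "\<dots> \<le> (\<integral>w. - ln e \<partial>circle_measure)"
          using b int_w by (intro integral_mono) auto
        also have "\<dots> = - ln e"
          using circle.M.prob_space by simp
        finally show ?thesis .
      qed
      then show "AE x in PiM F (\<lambda>_. circle_measure). norm (\<integral>w. \<phi> ?F (x(i := w)) \<partial>circle_measure) \<le> - ln e"
        by (auto simp: space_torus_measure)
    qed
    ultimately have "(\<integral>x. \<phi> F x \<partial>PiM F (\<lambda>_. circle_measure)) \<le>
        (\<integral>x. c i * (\<integral>w. \<phi> ?F (x(i := w)) \<partial>circle_measure) \<partial>PiM F (\<lambda>_. circle_measure))"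
      using i by (intro integral_mono int) (auto simp: space_torus_measure)
    also have "\<dots> = c i * (\<integral>x. \<phi> ?F x \<partial>PiM ?F (\<lambda>_. circle_measure))"
      using i by (simp add: circle.product_integral_insert int)
    finally have "(\<Prod>i\<in>F. c i) * (\<integral>x. \<phi> F x \<partial>PiM F (\<lambda>_. circle_measure)) \<le>
        (\<Prod>i\<in>F. c i) * (c i * (\<integral>x. \<phi> ?F x \<partial>PiM ?F (\<lambda>_. circle_measure)))"
      using i by (intro mult_left_mono prod_nonneg) (auto intro: c)
    then show ?case
      using insert.IH i by (simp add: mult_ac)
  qed
  then show ?thesis
    by (simp add: c_def \<phi>_def)
qed

section \<open>Vanishing at points of finite support\<close>

text \<open>Carries measures of sets in finitely many variables over to the infinite
  product.\<close>

lemma emeasure_torus_cylinder: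
  assumes "finite F" "F \<subseteq> I" "B \<in> sets (PiM F (\<lambda>_. circle_measure))"
  shows "{x \<in> torus I. restrict x F \<in> B} \<in> sets (torus_measure I)"
    and "emeasure (torus_measure I) {x \<in> torus I. restrict x F \<in> B} = emeasure (PiM F (\<lambda>_. circle_measure)) B"
proof -
  have *: "{x \<in> torus I. restrict x F \<in> B} = prod_emb I (\<lambda>_. circle_measure) F B"
    by (auto simp: prod_emb_def torus_def)
  show "{x \<in> torus I. restrict x F \<in> B} \<in> sets (torus_measure I)"
    unfolding * torus_measure_def using assms by (intro measurable_prod_emb) auto
  show "emeasure (torus_measure I) {x \<in> torus I. restrict x F \<in> B} = emeasure (PiM F (\<lambda>_. circle_measure)) B"
    unfolding * torus_measure_def using assms by (intro circle.emeasure_PiM_emb') auto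
qed

text \<open>For uncountable \<open>I\<close> the set \<open>K\<close> need not lie in the product
  sigma-algebra; the argument measures a cylinder that contains it.\<close>

lemma vanishes_at_finite_support:
  fixes h :: "('i \<Rightarrow> complex) \<Rightarrow> complex"
  assumes h: "h \<in> polydisc_algebra I" "\<And>z. z \<in> polydisc I \<Longrightarrow> norm (h z) \<le> 1"
    and K: "K \<subseteq> torus I" "outer_emeasure (torus_measure I) K > 0" "\<And>z. z \<in> K \<Longrightarrow> h z = 0"
    and a: "a \<in> PiE I (\<lambda>_. ball 0 1)" "finite {i \<in> I. a i \<noteq> 0}"
  shows "h a = 0"
proof (rule ccontr)
  assume ha: "h a \<noteq> 0"
  define c where "c i = (1 - norm (a i)) / (1 + norm (a i))" for i
  \<comment> \<open>Factors with \<open>a i = 0\<close> equal 1, so the product over any finite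
    \<open>F\<close> containing the support is this same \<open>C\<close>, whatever \<open>e\<close>
    is.\<close>
  define C where "C = (\<Prod>i\<in>{i \<in> I. a i \<noteq> 0}. c i)"
  have "C > 0"
    unfolding C_def c_def using a(1) by (intro prod_pos divide_pos_pos) (auto simp: PiE_iff add_pos_nonneg)
  obtain d where d: "d > 0" "ennreal d \<le> outer_emeasure (torus_measure I) K"
    using K(2) by (metis ennreal_cases ennreal_less_zero_iff order_refl top_greatest zero_less_one)
  have a': "a \<in> polydisc I"
    using a(1) ball_subset_cball unfolding polydisc_def PiE_iff by blast
  have cont: "continuous_map (polydisc_top I) euclidean h"
    using h(1) by (simp add: polydisc_algebra_def)
  have key: "ln (norm (h a)) \<le> C * d * ln e" if e: "0 < e" "e \<le> 1" for e
  proof -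
    obtain F where F: "finite F" "{i \<in> I. a i \<noteq> 0} \<subseteq> F" "F \<subseteq> I"
      and close: "\<And>z a. z \<in> polydisc I \<Longrightarrow> a \<in> polydisc I \<Longrightarrow> dist (h (merge F (I - F) (z, a))) (h z) < e"
      using polydisc_finite_dependence[OF cont e(1) a(2)] by auto
    let ?M = "PiM F (\<lambda>_. circle_measure)"
    define \<psi> where "\<psi> x = h (merge F (I - F) (x, a))" for x
    have [measurable]: "\<psi> \<in> borel_measurable ?M"
      unfolding \<psi>_def by (rule polydisc_continuous_measurable[OF cont F(1,3) a'])
    define B where "B = {x \<in> space ?M. norm (\<psi> x) \<le> e}"
    have [measurable]: "B \<in> sets ?M"
      unfolding B_def by measurable
    \<comment> \<open>On \<open>K\<close> the function \<open>h\<close> is 0, so its approximation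
      in the variables of \<open>F\<close> is at most \<open>e\<close> in modulus there.\<close>
    have "K \<subseteq> {x \<in> torus I. restrict x F \<in> B}"
    proof
      fix z assume z: "z \<in> K"
      then have zT: "z \<in> torus I" using K(1) by blast
      then have "dist (h (merge F (I - F) (z, a))) (h z) < e"
        using torus_subset_polydisc by (intro close a') auto
      moreover have "merge F (I - F) (restrict z F, a) = merge F (I - F) (z, a)"
        by (auto simp: merge_def fun_eq_iff)
      ultimately have "norm (\<psi> (restrict z F)) \<le> e"
        using K(3)[OF z] by (simp add: \<psi>_def)
      moreover have "restrict z F \<in> space ?M"
        using zT F(3) by (auto simp: space_torus_measure torus_def)
      ultimately show "z \<in> {x \<in> torus I. restrict x F \<in> B}"
        using zT by (simp add: B_def)
    qed
    then have "outer_emeasure (torus_measure I) K \<le> emeasure (torus_measure I) {x \<in> torus I. restrict x F \<in> B}"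
      unfolding outer_emeasure_def
      using emeasure_torus_cylinder(1)[OF F(1,3) \<open>B \<in> sets ?M\<close>] by (intro INF_lower) auto
    then have "ennreal d \<le> emeasure ?M B"
      using d(2) emeasure_torus_cylinder(2)[OF F(1,3) \<open>B \<in> sets ?M\<close>] by simp
    then have dB: "d \<le> measure ?M B"
      using d(1) by (simp add: circle.P.emeasure_eq_measure)
    have bnd: "ln e \<le> trunc_ln e (\<psi> x)" "trunc_ln e (\<psi> x) \<le> 0" if "x \<in> space ?M" for x
    proof -
      have "norm (\<psi> x) \<le> 1"
        unfolding \<psi>_def using that torus_subset_polydisc
        by (intro h(2) merge_in_polydisc F a') (auto simp: space_torus_measure)
      then show "ln e \<le> trunc_ln e (\<psi> x)" "trunc_ln e (\<psi> x) \<le> 0"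
        using trunc_ln_bounds[OF e] by blast+
    qed
    have int: "integrable ?M (\<lambda>x. trunc_ln e (\<psi> x))"
      using bnd by (intro circle.P.integrable_const_bound[of _ "- ln e"]) auto
    \<comment> \<open>The integrand equals \<open>ln e\<close> on \<open>B\<close> and is
      non-positive elsewhere.\<close>
    have "(\<integral>x. trunc_ln e (\<psi> x) \<partial>?M) \<le> (\<integral>x. ln e * indicator B x \<partial>?M)"
    proof (intro integral_mono int)
      fix x assume x: "x \<in> space ?M"
      show "trunc_ln e (\<psi> x) \<le> ln e * indicator B x"
        using bnd(2)[OF x] by (auto simp: B_def trunc_ln_def indicator_def max_def)
    qed (auto simp: circle.P.emeasure_eq_measure)
    also have "\<dots> = ln e * measure ?M B"
      by simp
    also have "\<dots> \<le> ln e * d"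
      using dB e by (intro mult_left_mono_neg) auto
    finally have "C * (\<integral>x. trunc_ln e (\<psi> x) \<partial>?M) \<le> C * (ln e * d)"
      using \<open>C > 0\<close> by (intro mult_left_mono) auto
    moreover have "(\<Prod>i\<in>F. c i) = C"
      unfolding C_def using F by (intro prod.mono_neutral_right) (auto simp: c_def)
    then have "trunc_ln e (h a) \<le> C * (\<integral>x. trunc_ln e (\<psi> x) \<partial>?M)"
      using trunc_ln_polydisc_mean[OF h e a(1) F(1,3)] by (simp add: c_def \<psi>_def)
    moreover have "ln (norm (h a)) \<le> trunc_ln e (h a)"
      using ha by (simp add: trunc_ln_def less_max_iff_disj)
    ultimately show ?thesis
      by (simp add: mult_ac)
  qed
  \<comment> \<open>Chosen so that \<open>e = exp (-t)\<close> makes \<open>C * d * ln e\<close>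
    smaller than \<open>ln (norm (h a))\<close>.\<close>
  define t where "t = (\<bar>ln (norm (h a))\<bar> + 1) / (C * d)"
  have t: "t > 0"
    unfolding t_def using \<open>C > 0\<close> d(1) by (intro divide_pos_pos) auto
  have "ln (norm (h a)) \<le> C * d * ln (exp (-t))"
    using t by (intro key) auto
  also have "\<dots> = - (\<bar>ln (norm (h a))\<bar> + 1)"
    using \<open>C > 0\<close> d(1) by (simp add: t_def)
  finally show False
    by linarith
qed

section \<open>Normalisation and conclusion\<close>

text \<open>Serves with \<open>c = 1\<close> for the difference and with \<open>c\<close> a bound of
  it for the normalised function.\<close>

lemma polydisc_algebra_diff_divide:
  assumes "f \<in> polydisc_algebra I" "g \<in> polydisc_algebra I"
  shows "(\<lambda>z. (f z - g z) / c) \<in> polydisc_algebra I"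
proof -
  have "continuous_map (polydisc_top I) euclidean ((\<lambda>w. w / c) \<circ> (\<lambda>z. f z - g z))"
    using assms
    by (intro continuous_map_compose[of _ euclidean] continuous_map_diff)
       (auto simp: polydisc_algebra_def divide_inverse intro!: continuous_intros)
  moreover have "continuous_on (cball 0 1) (\<lambda>w. (f (z(i := w)) - g (z(i := w))) / c)"
      "(\<lambda>w. (f (z(i := w)) - g (z(i := w))) / c) holomorphic_on ball 0 1"
    if "i \<in> I" "z \<in> polydisc I" for i z
    using polydisc_algebra_update[OF assms(1) that(2,1)] polydisc_algebra_update[OF assms(2) that(2,1)]
    by (auto simp: divide_inverse intro!: continuous_intros holomorphic_intros)
  ultimately show ?thesis
    by (simp add: polydisc_algebra_def o_def)
qed

lemma polydisc_algebra_bounded: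
  assumes "h \<in> polydisc_algebra I"
  shows "bounded (h ` polydisc I)"
proof -
  have "compactin (polydisc_top I) (polydisc I)"
    using compact_space_polydisc_top[of I] by (simp add: compact_space_def)
  then have "compactin euclidean (h ` polydisc I)"
    using assms by (intro image_compactin) (auto simp: polydisc_algebra_def)
  then show ?thesis
    by (simp add: compact_imp_bounded)
qed

theorem theorem3p5:
  fixes I :: "'i set" and K :: "('i \<Rightarrow> complex) set"
    and f g :: "('i \<Rightarrow> complex) \<Rightarrow> complex"
  assumes "I \<noteq> {}"
    and "compactin (torus_top I) K"
    and "outer_emeasure (torus_measure I) K > 0"
    and "f \<in> polydisc_algebra I" and "g \<in> polydisc_algebra I"
    and "\<forall>z\<in>K. f z = g z"
  shows "\<forall>z\<in>polydisc I. f z = g z"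
proof -
  have "(\<lambda>z. f z - g z) \<in> polydisc_algebra I"
    using polydisc_algebra_diff_divide[OF assms(4,5), of 1] by simp
  from polydisc_algebra_bounded[OF this]
  obtain M where M: "M > 0" "\<And>z. z \<in> polydisc I \<Longrightarrow> norm (f z - g z) \<le> M"
    unfolding bounded_pos by blast
  define h where "h z = (f z - g z) / of_real M" for z
  have h: "h \<in> polydisc_algebra I"
    unfolding h_def by (rule polydisc_algebra_diff_divide[OF assms(4,5)])
  have h1: "norm (h z) \<le> 1" if "z \<in> polydisc I" for z
    using M(1) M(2)[OF that] by (simp add: h_def norm_divide)
  have K: "K \<subseteq> torus I"
    using compactin_subset_topspace[OF assms(2)] by (simp add: torus_top_def torus_def)
  have hK: "h z = 0" if "z \<in> K" for z
    using assms(6) that by (simp add: h_def)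
  have "h z = 0" if "z \<in> polydisc I" for z
  proof (rule polydisc_zero_if_zero_on_finite_support[OF _ _ that])
    show "continuous_map (polydisc_top I) euclidean h"
      using h by (simp add: polydisc_algebra_def)
    show "h a = 0" if "a \<in> PiE I (\<lambda>_. ball 0 1)" "finite {i \<in> I. a i \<noteq> 0}" for a
      by (rule vanishes_at_finite_support[OF h h1 K assms(3) hK that])
  qed
  then show ?thesis
    using M(1) by (simp add: h_def)
qed

end
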